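(* Let $G$ be a locally gyroscopic invariant paratopological gyrogroup whose underlying topological space is Hausdorff. Then $G$ is functionally Hausdorff.
   Context: A gyrogroup is a nonempty set $G$ with a binary operation $\oplus$ such that: (G1) there is $e\in G$ with $e\oplus x=x=x\oplus e$ for all $x$; (G2) each $x\in G$ has an inverse $\ominus x$ with $\ominus x\oplus x=e=x\oplus(\ominus x)$; (G3) for all $x,y\in G$ there is an automorphism $\mathrm{gyr}[x,y]$ of the groupoid $(G,\oplus)$ (a bijection of $G$ preserving $\oplus$) with $x\oplus(y\oplus z)=(x\oplus y)\oplus \mathrm{gyr}[x,y](z)$ for all $z\in G$; (G4) $\mathrm{gyr}[x\oplus y,y]=\mathrm{gyr}[x,y]$ for all $x,y\in G$. (The map $\mathrm{gyr}[x,y]$ is then uniquely determined.) A paratopological gyrogroup is a gyrogroup $G$ with a topology such that $\oplus:G\times G\to G$ is (jointly) continuous, where $G\times G$ carries the product topology. For $V\subseteq G$, $\mathrm{gyr}[a,b]V=\{\mathrm{gyr}[a,b](v):v\in V\}$. A paratopological gyrogroup $G$ is locally gyroscopic invariant if there are a local base $\mathscr{B}$ at the identity $e$ and an open neighborhood $U$ of $e$ such that $\mathrm{gyr}[a,b]V\subseteq V$ for every $V\in\mathscr{B}$ and all $a,b\in U$. A space $X$ is functionally Hausdorff if for any distinct $x,y\in X$ there is a continuous function $f:X\to\mathbb{R}$ with $f(x)\neq f(y)$. *)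

theory Defs
  imports "HOL-Analysis.Analysis"
begin

definition groupoid_automorphism :: "'a set \<Rightarrow> ('a \<Rightarrow> 'a \<Rightarrow> 'a) \<Rightarrow> ('a \<Rightarrow> 'a) \<Rightarrow> bool" where
  "groupoid_automorphism G add h \<longleftrightarrow>
     bij_betw h G G \<and> (\<forall>x\<in>G. \<forall>y\<in>G. h (add x y) = add (h x) (h y))"

text \<open>The identity \<open>e\<close> and the maps \<open>gyr x y\<close> are parameters; on \<open>G\<close> both are uniquely
  determined by the operation. As \<open>gyr x y\<close> is arbitrary outside \<open>G\<close>, equality of gyrations is
  required pointwise on \<open>G\<close> only. Non-emptiness of \<open>G\<close> follows from \<open>e \<in> G\<close>.\<close>

locale gyrogroup =
  fixes G :: "'a set"
    and add :: "'a \<Rightarrow> 'a \<Rightarrow> 'a" (infixl \<open>\<oplus>\<close> 65)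
    and e :: 'a
    and gyr :: "'a \<Rightarrow> 'a \<Rightarrow> 'a \<Rightarrow> 'a"
  assumes add_closed: "\<lbrakk>x \<in> G; y \<in> G\<rbrakk> \<Longrightarrow> x \<oplus> y \<in> G"
    and e_closed: "e \<in> G"
    and left_id: "x \<in> G \<Longrightarrow> e \<oplus> x = x"
    and right_id: "x \<in> G \<Longrightarrow> x \<oplus> e = x"
    and inverse_ex: "x \<in> G \<Longrightarrow> \<exists>y\<in>G. y \<oplus> x = e \<and> x \<oplus> y = e"
    and gyr_automorphism: "\<lbrakk>x \<in> G; y \<in> G\<rbrakk> \<Longrightarrow> groupoid_automorphism G add (gyr x y)"
    and left_gyroassoc:
      "\<lbrakk>x \<in> G; y \<in> G; z \<in> G\<rbrakk> \<Longrightarrow> x \<oplus> (y \<oplus> z) = (x \<oplus> y) \<oplus> gyr x y z"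
    and left_loop: "\<lbrakk>x \<in> G; y \<in> G; z \<in> G\<rbrakk> \<Longrightarrow> gyr (x \<oplus> y) y z = gyr x y z"

locale paratopological_gyrogroup = gyrogroup G add e gyr
  for G :: "'a set"
    and add :: "'a \<Rightarrow> 'a \<Rightarrow> 'a" (infixl \<open>\<oplus>\<close> 65)
    and e :: 'a
    and gyr :: "'a \<Rightarrow> 'a \<Rightarrow> 'a \<Rightarrow> 'a" +
  fixes T :: "'a topology"
  assumes topspace_eq: "topspace T = G"
    and continuous_add: "continuous_map (prod_topology T T) T (\<lambda>(x, y). x \<oplus> y)"

definition local_base_at :: "'a topology \<Rightarrow> 'a \<Rightarrow> 'a set set \<Rightarrow> bool" where
  "local_base_at T x \<B> \<longleftrightarrow>
     (\<forall>V\<in>\<B>. openin T V \<and> x \<in> V) \<and>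
     (\<forall>W. openin T W \<and> x \<in> W \<longrightarrow> (\<exists>V\<in>\<B>. V \<subseteq> W))"

definition locally_gyroscopic_invariant ::
    "'a \<Rightarrow> ('a \<Rightarrow> 'a \<Rightarrow> 'a \<Rightarrow> 'a) \<Rightarrow> 'a topology \<Rightarrow> bool" where
  "locally_gyroscopic_invariant e gyr T \<longleftrightarrow>
     (\<exists>\<B> U. local_base_at T e \<B> \<and> openin T U \<and> e \<in> U \<and>
        (\<forall>V\<in>\<B>. \<forall>a\<in>U. \<forall>b\<in>U. gyr a b ` V \<subseteq> V))"

definition functionally_Hausdorff_space :: "'a topology \<Rightarrow> bool" where
  "functionally_Hausdorff_space X \<longleftrightarrow>
     (\<forall>x\<in>topspace X. \<forall>y\<in>topspace X. x \<noteq> y \<longrightarrow>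
        (\<exists>f. continuous_map X euclideanreal f \<and> f x \<noteq> f y))"

end

theory Submission
  imports Defs
begin

text \<open>The topology of a Hausdorff paratopological gyrogroup need not be regular, but left translations
  are homeomorphisms, so \<open>closure A \<oplus> V\<close> is an open subset of \<open>closure (A \<oplus> V)\<close> for every open
  \<open>V\<close>. Urysohn's construction therefore works for the relation ``\<open>A \<oplus> V \<subseteq> B\<close> for some basic
  neighbourhood \<open>V\<close> of \<open>e\<close>'', which has interpolants: if \<open>V' \<oplus> V' \<subseteq> V\<close>, then \<open>A \<oplus> V'\<close> lies
  between \<open>A\<close> and \<open>A \<oplus> V\<close>, since \<open>(a \<oplus> v) \<oplus> w = a \<oplus> (v \<oplus> gyr v (a \<oplus> v) w)\<close> and
  \<open>gyr v (a \<oplus> v)\<close> preserves \<open>V'\<close> as long as all sets stay inside the neighbourhood given by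
  local gyroscopic invariance. This separates \<open>e\<close> from any other point, and translating gives the
  general case.\<close>

section \<open>Urysohn functions from an interpolating relation\<close>

lemma dyadic_between:
  fixes a b :: real
  assumes "0 \<le> a" "a < b" "b \<le> 1"
  obtains r where "r \<in> dyadics" "0 \<le> r" "r \<le> 1" "a < r" "r < b"
proof -
  have "0 < b - a" "1 < (2::real)" "0 < b"
    using assms by auto
  \<comment> \<open>The two dyadics straddle \<open>b\<close> at distance less than
    \<open>b - a\<close>, so the lower one lies above \<open>a\<close>.\<close>
  from padic_rational_approximation_straddle_pos[OF this]
  obtain n q r where "real q / 2^n < b" "b < real r / 2^n" "\<bar>real q / 2^n - real r / 2^n\<bar> < b - a" .
  moreover have "real q / 2^n \<in> dyadics" "0 \<le> real q / 2^n"
    by (auto simp: dyadics_def)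
  ultimately show thesis
    using assms by (intro that[of "real q / 2^n"]) linarith+
qed

text \<open>Interpolation plays the role of normality: it fills in sets indexed by the dyadic
  fractions of [0, 1]. Assumption \<open>closure\<close> then makes their closures
  \<open>K r\<close> so strictly nested that interiors of the \<open>K r\<close> witness openness of
  \<open>f < a\<close> and complements witness openness of \<open>f > a\<close>.\<close>

lemma Urysohn_interpolating_relation:
  assumes "R A B"
    and interpolate: "\<And>P Q. R P Q \<Longrightarrow> \<exists>C. R P C \<and> R C Q"
    and trans: "\<And>P C Q. R P C \<Longrightarrow> R C Q \<Longrightarrow> R P Q"
    and closure: "\<And>P Q. R P Q \<Longrightarrow> X closure_of P \<subseteq> X interior_of (X closure_of Q)"
  obtains f where "continuous_map X euclideanreal f"
    "\<And>z. z \<in> X closure_of A \<Longrightarrow> f z = (0::real)"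
    "\<And>z. z \<notin> X closure_of B \<Longrightarrow> f z = 1"
proof -
  define D :: "real set" where "D = dyadics \<inter> {0..1}"
  have "\<exists>H. H 0 = A \<and> H 1 = B \<and> (\<forall>r\<in>D. \<forall>s\<in>D. r < s \<longrightarrow> R (H r) (H s))"
    unfolding D_def using assms by (intro recursion_on_dyadic_fractions) blast+
  then obtain H where H: "H 0 = A" "H 1 = B"
    "\<And>r s. r \<in> D \<Longrightarrow> s \<in> D \<Longrightarrow> r < s \<Longrightarrow> R (H r) (H s)"
    by blast
  define K where "K r = X closure_of (H r)" for r
  have K_interior: "K r \<subseteq> X interior_of K s" if "r \<in> D" "s \<in> D" "r < s" for r s
    unfolding K_def using closure H(3) that by blast
  have K_mono: "K r \<subseteq> K s" if "r \<in> D" "s \<in> D" "r \<le> s" for r s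
    using K_interior[of r s] interior_of_subset[of X "K s"] that by (cases "r = s") auto
  have D01: "0 \<in> D" "1 \<in> D" and D_bounds: "\<And>r. r \<in> D \<Longrightarrow> 0 \<le> r \<and> r \<le> 1"
    by (force simp: D_def dyadics_def)+
  \<comment> \<open>Inserting 1 keeps the infimum over a nonempty set and gives the value 1 at
    points in no \<open>K r\<close>.\<close>
  define f where "f z = Inf (insert 1 {r \<in> D. z \<in> K r})" for z
  have bdd: "bdd_below (insert 1 {r \<in> D. z \<in> K r})" for z
    by (rule bdd_belowI[of _ 0]) (use D_bounds in auto)
  have f_le: "f z \<le> r" if "r \<in> D" "z \<in> K r" for z r
    unfolding f_def using that by (intro cInf_lower bdd) auto
  have f_le_1: "f z \<le> 1" for z
    unfolding f_def by (intro cInf_lower bdd) auto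
  have f_ge: "b \<le> f z" if "b \<le> 1" "\<And>r. r \<in> D \<Longrightarrow> z \<in> K r \<Longrightarrow> b \<le> r" for z b
    unfolding f_def using that by (intro cInf_greatest) auto
  have f_ge_0: "0 \<le> f z" for z
    using f_ge[of 0] D_bounds by auto
  have f_lessE: "\<exists>r\<in>D. r < a \<and> z \<in> K r" if "f z < a" "a \<le> 1" for a z
    using f_ge[of a z] that by force
  have "openin X {z \<in> topspace X. f z < a}" for a
  proof (subst openin_subopen, intro ballI)
    fix z assume z: "z \<in> {z \<in> topspace X. f z < a}"
    show "\<exists>W. openin X W \<and> z \<in> W \<and> W \<subseteq> {z \<in> topspace X. f z < a}"
    proof (cases "a \<le> 1")
      case True
      then obtain r where r: "r \<in> D" "r < a" "z \<in> K r"
        using f_lessE z by auto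
      then obtain s where s: "s \<in> D" "r < s" "s < a"
        using dyadic_between[of r a] True D_bounds unfolding D_def by (metis IntI atLeastAtMost_iff)
      have "z \<in> X interior_of K s"
        using K_interior r s by blast
      moreover have "X interior_of K s \<subseteq> {z \<in> topspace X. f z < a}"
        using f_le s interior_of_subset[of X "K s"] interior_of_subset_topspace[of X "K s"]
        by fastforce
      ultimately show ?thesis
        using openin_interior_of by (intro exI[of _ "X interior_of K s"]) simp
    next
      case False
      then have "{z \<in> topspace X. f z < a} = topspace X"
        using le_less_trans[OF f_le_1, of a] by auto
      then show ?thesis using z by blast
    qed
  qed
  moreover have "openin X {z \<in> topspace X. f z > a}" for a
  proof (subst openin_subopen, intro ballI)
    fix z assume z: "z \<in> {z \<in> topspace X. f z > a}"
    show "\<exists>W. openin X W \<and> z \<in> W \<and> W \<subseteq> {z \<in> topspace X. f z > a}"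
    proof (cases "a \<ge> 0")
      case True
      then obtain r where r: "r \<in> D" "a < r" "r < f z"
        using dyadic_between[of a "f z"] z f_le_1[of z] unfolding D_def
        by (metis IntI atLeastAtMost_iff mem_Collect_eq)
      \<comment> \<open>By monotonicity a point outside \<open>K r\<close> lies in no
        \<open>K s\<close> with \<open>s \<le> r\<close>. So \<open>f \<ge> r > a\<close> on the
        complement of the closed set \<open>K r\<close>, which contains \<open>z\<close> because
        \<open>r < f z\<close>.\<close>
      have "r \<le> f w" if "w \<notin> K r" for w
        using f_ge[of r w] K_mono[of _ r] r D_bounds that by (meson linear subsetD)
      then have "topspace X - K r \<subseteq> {z \<in> topspace X. f z > a}"
        using r by force
      moreover have "openin X (topspace X - K r)"
        by (simp add: K_def openin_diff)
      moreover have "z \<in> topspace X - K r"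
        using z f_le r by force
      ultimately show ?thesis by blast
    next
      case False
      then have "{z \<in> topspace X. f z > a} = topspace X"
        using less_le_trans[OF _ f_ge_0, of a] by auto
      then show ?thesis using z by blast
    qed
  qed
  ultimately have "continuous_map X euclideanreal f"
    by (auto simp: continuous_map_upper_lower_semicontinuous_lt)
  moreover have "f z = 0" if "z \<in> X closure_of A" for z
    using f_le[of 0 z] f_ge_0[of z] D01 that by (auto simp: K_def H)
  moreover have "f z = 1" if "z \<notin> X closure_of B" for z
  proof -
    have "1 \<le> f z"
      using K_mono[of _ 1] D01 D_bounds that by (intro f_ge) (auto simp: K_def H)
    with f_le_1[of z] show ?thesis by simp
  qed
  ultimately show thesis by (rule that)
qed

section \<open>Cancellation and associativity in gyrogroups\<close>

context gyrogroup
begin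

lemma gyr_closed: "\<lbrakk>x \<in> G; y \<in> G; z \<in> G\<rbrakk> \<Longrightarrow> gyr x y z \<in> G"
  using gyr_automorphism[of x y] by (auto simp: groupoid_automorphism_def bij_betw_def)

lemma gyr_inj: "\<lbrakk>x \<in> G; y \<in> G; z \<in> G; w \<in> G; gyr x y z = gyr x y w\<rbrakk> \<Longrightarrow> z = w"
  using gyr_automorphism[of x y]
  by (auto simp: groupoid_automorphism_def bij_betw_def dest: inj_onD)

lemma add_left_inj:
  assumes "x \<in> G" "z \<in> G" "w \<in> G" "x \<oplus> z = x \<oplus> w"
  shows "z = w"
proof -
  obtain y where y: "y \<in> G" "y \<oplus> x = e"
    using inverse_ex assms by blast
  \<comment> \<open>Adding a left inverse \<open>y\<close> of \<open>x\<close> turns left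
    translation by \<open>x\<close> into a gyration, which is injective.\<close>
  have "gyr y x u = y \<oplus> (x \<oplus> u)" if "u \<in> G" for u
    using left_gyroassoc[of y x u] y assms that left_id[OF gyr_closed[of y x u]] by simp
  then show ?thesis
    using gyr_inj[of y x z w] y assms by simp
qed

text \<open>By the loop property \<open>y \<oplus> x = e\<close> gives
  \<open>gyr y x = gyr e x\<close> on \<open>G\<close>, and \<open>gyr e x\<close> is the identity
  there by gyroassociativity with first argument \<open>e\<close> and left injectivity.\<close>

lemma left_cancel:
  assumes "x \<in> G" "y \<in> G" "z \<in> G" "y \<oplus> x = e"
  shows "y \<oplus> (x \<oplus> z) = z"
proof -
  have "x \<oplus> gyr e x z = x \<oplus> z"
    using left_gyroassoc[of e x z] assms e_closed by (simp add: left_id add_closed)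
  then have "gyr e x z = z"
    using add_left_inj assms gyr_closed e_closed by blast
  then have "gyr y x z = z"
    using left_loop[of y x z] assms by simp
  then show ?thesis
    using left_gyroassoc[of y x z] assms by (simp add: left_id)
qed

text \<open>With \<open>b\<close> inverse to \<open>a\<close>, the loop property for the pair
  \<open>b\<close>, \<open>a \<oplus> v\<close> replaces \<open>b\<close> by
  \<open>b \<oplus> (a \<oplus> v) = v\<close>. This matters because \<open>b\<close> need not be
  near \<open>e\<close>, while \<open>v\<close> and \<open>a \<oplus> v\<close> will be.\<close>

lemma right_gyroassoc:
  assumes "a \<in> G" "v \<in> G" "w \<in> G"
  shows "(a \<oplus> v) \<oplus> w = a \<oplus> (v \<oplus> gyr v (a \<oplus> v) w)"
proof -
  obtain b where b: "b \<in> G" "b \<oplus> a = e" "a \<oplus> b = e"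
    using inverse_ex assms by blast
  have bav: "b \<oplus> (a \<oplus> v) = v"
    using left_cancel b assms by blast
  have "b \<oplus> ((a \<oplus> v) \<oplus> w) = v \<oplus> gyr b (a \<oplus> v) w"
    using left_gyroassoc[of b "a \<oplus> v" w] b assms by (simp add: bav add_closed)
  also have "gyr b (a \<oplus> v) w = gyr v (a \<oplus> v) w"
    using left_loop[of b "a \<oplus> v" w] b assms by (simp add: bav add_closed)
  finally show ?thesis
    using left_cancel[of b a "(a \<oplus> v) \<oplus> w"] b assms by (simp add: add_closed)
qed

definition set_add :: "'a set \<Rightarrow> 'a set \<Rightarrow> 'a set" (infixl \<open>\<oplus>\<oplus>\<close> 65) where
  "A \<oplus>\<oplus> B = {a \<oplus> b |a b. a \<in> A \<and> b \<in> B}"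

lemma set_add_mono: "A \<subseteq> A' \<Longrightarrow> B \<subseteq> B' \<Longrightarrow> A \<oplus>\<oplus> B \<subseteq> A' \<oplus>\<oplus> B'"
  by (auto simp: set_add_def)

lemma subset_set_add: "A \<subseteq> G \<Longrightarrow> e \<in> V \<Longrightarrow> A \<subseteq> A \<oplus>\<oplus> V"
  using right_id by (force simp: set_add_def)

lemma set_add_assoc_subset:
  assumes "A \<subseteq> G" "V \<subseteq> G"
    and "\<And>a v w. \<lbrakk>a \<in> A; v \<in> V; w \<in> V\<rbrakk> \<Longrightarrow> gyr v (a \<oplus> v) w \<in> V"
  shows "(A \<oplus>\<oplus> V) \<oplus>\<oplus> V \<subseteq> A \<oplus>\<oplus> (V \<oplus>\<oplus> V)"
proof
  fix x assume "x \<in> (A \<oplus>\<oplus> V) \<oplus>\<oplus> V"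
  then obtain a v w where avw: "a \<in> A" "v \<in> V" "w \<in> V" "x = (a \<oplus> v) \<oplus> w"
    by (auto simp: set_add_def)
  then have "x = a \<oplus> (v \<oplus> gyr v (a \<oplus> v) w)"
    using right_gyroassoc[of a v w] assms(1,2) by auto
  with avw assms(3) show "x \<in> A \<oplus>\<oplus> (V \<oplus>\<oplus> V)"
    unfolding set_add_def by blast
qed

end

section \<open>Translations, closures and separation from the identity\<close>

context paratopological_gyrogroup
begin

lemma continuous_left_translation: "x \<in> G \<Longrightarrow> continuous_map T T (\<lambda>y. x \<oplus> y)"
  using continuous_map_compose[OF _ continuous_add, of T "\<lambda>y. (x, y)"]
  by (simp add: o_def continuous_map_pairwise topspace_eq)

lemma continuous_right_translation: "y \<in> G \<Longrightarrow> continuous_map T T (\<lambda>x. x \<oplus> y)"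
  using continuous_map_compose[OF _ continuous_add, of T "\<lambda>x. (x, y)"]
  by (simp add: o_def continuous_map_pairwise topspace_eq)

text \<open>By left cancellation, translation by the inverse \<open>y\<close> undoes translation by
  \<open>x\<close>, so the image is a preimage under a continuous map.\<close>

lemma openin_left_translation:
  assumes "x \<in> G" "openin T V"
  shows "openin T ((\<lambda>y. x \<oplus> y) ` V)"
proof -
  obtain y where y: "y \<in> G" "y \<oplus> x = e" "x \<oplus> y = e"
    using inverse_ex assms by blast
  have "V \<subseteq> G"
    using assms openin_subset topspace_eq by blast
  have "(\<lambda>z. x \<oplus> z) ` V = {z \<in> topspace T. y \<oplus> z \<in> V}"
  proof (intro equalityI subsetI)
    fix z assume "z \<in> (\<lambda>z. x \<oplus> z) ` V"
    then show "z \<in> {z \<in> topspace T. y \<oplus> z \<in> V}"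
      using left_cancel[of x y] y assms(1) \<open>V \<subseteq> G\<close> by (auto simp: topspace_eq add_closed subset_iff)
  next
    fix z assume "z \<in> {z \<in> topspace T. y \<oplus> z \<in> V}"
    then show "z \<in> (\<lambda>z. x \<oplus> z) ` V"
      using left_cancel[of y x z] y assms(1) by (intro image_eqI[of _ _ "y \<oplus> z"]) (auto simp: topspace_eq)
  qed
  then show ?thesis
    using openin_continuous_map_preimage[OF continuous_left_translation] y assms by simp
qed

lemma openin_set_add: "A \<subseteq> G \<Longrightarrow> openin T V \<Longrightarrow> openin T (A \<oplus>\<oplus> V)"
proof -
  assume "A \<subseteq> G" "openin T V"
  moreover have "A \<oplus>\<oplus> V = (\<Union>a\<in>A. (\<lambda>v. a \<oplus> v) ` V)"
    by (auto simp: set_add_def)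
  ultimately show ?thesis
    using openin_left_translation by (auto intro!: openin_Union)
qed

lemma closure_set_add_subset:
  assumes "V \<subseteq> G"
  shows "(T closure_of A) \<oplus>\<oplus> V \<subseteq> T closure_of (A \<oplus>\<oplus> V)"
proof
  fix x assume "x \<in> (T closure_of A) \<oplus>\<oplus> V"
  then obtain a v where av: "a \<in> T closure_of A" "v \<in> V" "x = a \<oplus> v"
    by (auto simp: set_add_def)
  \<comment> \<open>Right translations enter only through continuity: the image of a closure lies in
    the closure of the image.\<close>
  then have "x \<in> T closure_of ((\<lambda>x. x \<oplus> v) ` A)"
    using continuous_map_image_closure_subset[OF continuous_right_translation] assms by blast
  also have "\<dots> \<subseteq> T closure_of (A \<oplus>\<oplus> V)"
    using av by (intro closure_of_mono) (auto simp: set_add_def)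
  finally show "x \<in> T closure_of (A \<oplus>\<oplus> V)" .
qed

text \<open>The open set that fits in between is \<open>(T closure_of A) \<oplus>\<oplus> V\<close>,
  a union of left translates of \<open>V\<close>. It contains the closure of \<open>A\<close> since
  \<open>e \<in> V\<close>.\<close>

lemma closure_subset_interior_closure_set_add:
  assumes "openin T V" "e \<in> V" "A \<oplus>\<oplus> V \<subseteq> B"
  shows "T closure_of A \<subseteq> T interior_of (T closure_of B)"
proof -
  have cl: "T closure_of A \<subseteq> G"
    using closure_of_subset_topspace[of T A] topspace_eq by simp
  have "V \<subseteq> G"
    using assms openin_subset topspace_eq by blast
  then have "(T closure_of A) \<oplus>\<oplus> V \<subseteq> T closure_of B"
    using closure_set_add_subset[of V A] closure_of_mono[OF assms(3), of T] by blast
  then have "(T closure_of A) \<oplus>\<oplus> V \<subseteq> T interior_of (T closure_of B)"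
    using openin_set_add cl assms by (intro interior_of_maximal) auto
  then show ?thesis
    using subset_set_add[OF cl] assms by blast
qed

lemma set_add_square_subset:
  assumes "local_base_at T e \<B>" "openin T W" "e \<in> W"
  obtains V where "V \<in> \<B>" "V \<oplus>\<oplus> V \<subseteq> W"
proof -
  define M where "M = {p \<in> topspace (prod_topology T T). (\<lambda>(x, y). x \<oplus> y) p \<in> W}"
  have "openin (prod_topology T T) M"
    unfolding M_def using continuous_add assms(2) by (rule openin_continuous_map_preimage)
  moreover have "(e, e) \<in> M"
    using assms by (simp add: M_def topspace_eq e_closed left_id)
  ultimately obtain P Q where PQ: "openin T P" "openin T Q" "e \<in> P" "e \<in> Q" "P \<times> Q \<subseteq> M"
    by (metis openin_prod_topology_alt)
  then have "openin T (P \<inter> Q) \<and> e \<in> P \<inter> Q"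
    by auto
  then obtain V where V: "V \<in> \<B>" "V \<subseteq> P \<inter> Q"
    using assms(1) unfolding local_base_at_def by blast
  have "p \<oplus> q \<in> W" if "p \<in> P" "q \<in> Q" for p q
    using subsetD[OF PQ(5), of "(p, q)"] that by (simp add: M_def)
  then have "V \<oplus>\<oplus> V \<subseteq> W"
    using V by (auto simp: set_add_def)
  with V(1) show thesis by (rule that)
qed

lemma continuous_function_separating_e:
  assumes "locally_gyroscopic_invariant e gyr T" "Hausdorff_space T" "y \<in> G" "y \<noteq> e"
  obtains f where "continuous_map T euclideanreal f" "f e \<noteq> f y"
proof -
  obtain \<B> U where \<B>: "local_base_at T e \<B>" and U: "openin T U" "e \<in> U"
    and inv: "\<And>V a b. \<lbrakk>V \<in> \<B>; a \<in> U; b \<in> U\<rbrakk> \<Longrightarrow> gyr a b ` V \<subseteq> V"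
    using assms(1) unfolding locally_gyroscopic_invariant_def by metis
  have \<B>_open: "openin T V" "e \<in> V" if "V \<in> \<B>" for V
    using \<B> that by (auto simp: local_base_at_def)
  have UG: "U \<subseteq> G"
    using U openin_subset topspace_eq by blast
  obtain P Q where PQ: "openin T P" "openin T Q" "e \<in> P" "y \<in> Q" "disjnt P Q"
    using assms(2-4) e_closed unfolding Hausdorff_space_def topspace_eq by metis
  have "openin T (P \<inter> U) \<and> e \<in> P \<inter> U"
    using U PQ by auto
  then obtain V0 where V0: "V0 \<in> \<B>" "V0 \<subseteq> P \<inter> U"
    using \<B> unfolding local_base_at_def by blast
  \<comment> \<open>The bound \<open>B \<subseteq> U\<close> keeps every interpolated set where
    gyrations preserve basic neighbourhoods; \<open>A \<subseteq> B\<close> puts \<open>A\<close>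
    there too and yields transitivity.\<close>
  define R where "R A B \<longleftrightarrow> B \<subseteq> U \<and> A \<subseteq> B \<and> (\<exists>V\<in>\<B>. A \<oplus>\<oplus> V \<subseteq> B)" for A B
  have "e \<oplus> v = v" if "v \<in> V0" for v
    using that V0 UG left_id by blast
  then have "{e} \<oplus>\<oplus> V0 \<subseteq> V0"
    by (auto simp: set_add_def)
  then have "R {e} V0"
    unfolding R_def using V0 \<B>_open[OF V0(1)] by blast
  moreover have "\<exists>C. R A C \<and> R C B" if "R A B" for A B
  proof -
    obtain V where V: "V \<in> \<B>" "A \<oplus>\<oplus> V \<subseteq> B" and AB: "A \<subseteq> B" "B \<subseteq> U"
      using \<open>R A B\<close> unfolding R_def by blast
    \<comment> \<open>Intersecting with \<open>U\<close> forces \<open>W \<subseteq> U\<close>, as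
      \<open>e \<in> W\<close>. Then for \<open>a \<in> A\<close> and \<open>v \<in> W\<close> both
      \<open>v\<close> and \<open>a \<oplus> v\<close> lie in \<open>U\<close>, so
      \<open>gyr v (a \<oplus> v)\<close> maps \<open>W\<close> into itself.\<close>
    obtain W where W: "W \<in> \<B>" "W \<oplus>\<oplus> W \<subseteq> V \<inter> U"
      using set_add_square_subset[OF \<B>, of "V \<inter> U"] \<B>_open[OF V(1)] U by auto
    have WG: "W \<subseteq> G"
      using \<B>_open(1)[OF W(1)] openin_subset topspace_eq by blast
    have WV: "W \<subseteq> V \<inter> U"
      using subset_set_add[OF WG \<B>_open(2)[OF W(1)]] W by blast
    have AG: "A \<subseteq> G"
      using AB UG by blast
    have AW: "A \<oplus>\<oplus> W \<subseteq> B"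
      using set_add_mono[of A A W V] WV V by blast
    have "(A \<oplus>\<oplus> W) \<oplus>\<oplus> W \<subseteq> A \<oplus>\<oplus> (W \<oplus>\<oplus> W)"
    proof (rule set_add_assoc_subset[OF AG WG])
      fix a v w assume "a \<in> A" "v \<in> W" "w \<in> W"
      moreover from this have "a \<oplus> v \<in> U"
        using AW AB by (auto simp: set_add_def)
      ultimately show "gyr v (a \<oplus> v) w \<in> W"
        using inv[OF W(1), of v "a \<oplus> v"] WV by blast
    qed
    also have "\<dots> \<subseteq> B"
      using set_add_mono[of A A "W \<oplus>\<oplus> W" V] W V by blast
    finally have "R (A \<oplus>\<oplus> W) B"
      using AW AB W unfolding R_def by blast
    moreover have "R A (A \<oplus>\<oplus> W)"
      using AW AB W subset_set_add[OF AG \<B>_open(2)[OF W(1)]] unfolding R_def by blast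
    ultimately show ?thesis by blast
  qed
  moreover have "R A C" if "R A B" "R B C" for A B C
    using that set_add_mono[of A B, OF _ order_refl] unfolding R_def by (meson order_trans)
  moreover have "T closure_of A \<subseteq> T interior_of (T closure_of B)" if "R A B" for A B
    using that closure_subset_interior_closure_set_add \<B>_open unfolding R_def by meson
  ultimately obtain f where f: "continuous_map T euclideanreal f"
    "\<And>z. z \<in> T closure_of {e} \<Longrightarrow> f z = 0" "\<And>z. z \<notin> T closure_of V0 \<Longrightarrow> f z = 1"
    by (rule Urysohn_interpolating_relation) blast+
  have "e \<in> T closure_of {e}"
    using closure_of_subset[of "{e}" T] e_closed topspace_eq by auto
  \<comment> \<open>\<open>Q\<close> is a neighbourhood of \<open>y\<close> disjoint from
    \<open>P\<close>, hence from \<open>V0\<close>.\<close>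
  moreover have "y \<notin> T closure_of V0"
    using V0 PQ by (auto simp: in_closure_of disjnt_iff)
  ultimately have "f e \<noteq> f y"
    using f by simp
  with f(1) show thesis by (rule that)
qed

end

theorem theorem3p3:
  fixes G :: "'a set"
    and add :: "'a \<Rightarrow> 'a \<Rightarrow> 'a"
    and e :: 'a
    and gyr :: "'a \<Rightarrow> 'a \<Rightarrow> 'a \<Rightarrow> 'a"
    and T :: "'a topology"
  assumes "paratopological_gyrogroup G add e gyr T"
    and "locally_gyroscopic_invariant e gyr T"
    and "Hausdorff_space T"
  shows "functionally_Hausdorff_space T"
proof -
  interpret paratopological_gyrogroup G add e gyr T by fact
  show ?thesis
    unfolding functionally_Hausdorff_space_def topspace_eq
  proof (intro ballI impI)
    fix x y assume xy: "x \<in> G" "y \<in> G" "x \<noteq> y"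
    obtain b where b: "b \<in> G" "add b x = e" "add x b = e"
      using inverse_ex xy by blast
    \<comment> \<open>Left translation by \<open>b\<close> sends \<open>x\<close> to
      \<open>e\<close> and, being injective, keeps the image of \<open>y\<close> away from
      \<open>e\<close>.\<close>
    have "add b y \<noteq> e"
      using add_left_inj[of b x y] b xy by auto
    then obtain f where f: "continuous_map T euclideanreal f" "f e \<noteq> f (add b y)"
      using continuous_function_separating_e[OF assms(2,3)] add_closed b xy by metis
    have "continuous_map T euclideanreal (\<lambda>z. f (add b z))"
      using continuous_map_compose[OF continuous_left_translation f(1)] b by (simp add: o_def)
    with f(2) b show "\<exists>f. continuous_map T euclideanreal f \<and> f x \<noteq> f y"
      by (intro exI[of _ "\<lambda>z. f (add b z)"]) simp
  qed
qed

end
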